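(* Let $$N_1=\begin{pmatrix}7&0&-6\\4&-1&-4\\4&1&-3\end{pmatrix},\quad N_2=\begin{pmatrix}7&0&6\\4&-1&3\\4&1&4\end{pmatrix},\quad N_3=\begin{pmatrix}7&6&6\\4&4&3\\4&3&4\end{pmatrix},$$ $$N_4=\begin{pmatrix}7&6&0\\4&4&1\\4&3&-1\end{pmatrix},\quad N_5=\begin{pmatrix}7&-6&0\\4&-3&1\\4&-4&-1\end{pmatrix}.$$ An integer sided triangle is primitive sub-Eisensteinian if and only if it has side lengths $(a,b,c)$ or $(a,c,b)$ such that $$\begin{pmatrix} a \\ {b} \\ {c} \end{pmatrix}=N\cdot v,\qquad v\in\left\{\begin{pmatrix}7\\5\\3\end{pmatrix},\begin{pmatrix}13\\7\\8\end{pmatrix}\right\},$$ where $N$ is a finite (possibly empty) product of matrices from $\{N_1,N_2,N_3,N_4,N_5\}$. Any such triangle is obtained exactly once; that is, each ordered triple of side lengths of a primitive sub-Eisensteinian triangle arises from exactly one choice of a finite word in $N_1,\dots,N_5$ (whose product is $N$), a vector $v$ from the two listed, and one of the two forms $(a,b,c)$ or $(a,c,b)$.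
   Context: A primitive sub-Eisensteinian triangle is an integer sided triangle with side lengths $(a,b,c)$ (positive integers) such that the angle opposite the side of length $a$ is $120^\circ$ and $\gcd(a,b,c)=1$. By the law of cosines, the angle condition says $a^2=b^2+c^2+bc$. Here triangles are represented by ordered triples of side lengths, with the side opposite the $120^\circ$ angle listed first; no order is imposed on the other two sides, so $(a,b,c)$ and $(a,c,b)$ count as different triples. The empty product of matrices is the $3\times 3$ identity matrix. *)

theory Defs
  imports "HOL-Analysis.Analysis"
begin

definition angle_at :: "real^2 \<Rightarrow> real^2 \<Rightarrow> real^2 \<Rightarrow> real" where
  "angle_at A B C = arccos ((B - A) \<bullet> (C - A) / (norm (B - A) * norm (C - A)))"

(* The triangle is the ordered triple of its side lengths: a is opposite the vertex A
   carrying the angle of 120 degrees, and no order is imposed on b and c. *)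
definition primitive_sub_eisensteinian :: "int \<Rightarrow> int \<Rightarrow> int \<Rightarrow> bool" where
  "primitive_sub_eisensteinian a b c \<longleftrightarrow>
     a > 0 \<and> b > 0 \<and> c > 0 \<and> gcd a (gcd b c) = 1 \<and>
     (\<exists>A B C :: real^2. \<not> collinear {A, B, C} \<and>
        dist B C = of_int a \<and> dist C A = of_int b \<and> dist A B = of_int c \<and>
        angle_at A B C = 2 * pi / 3)"

lemma norm_real_2: "norm (x::real^2) = sqrt ((x$1)^2 + (x$2)^2)"
  by (simp add: norm_vec_def L2_set_def sum_2)

lemma angle_120_iff_law_of_cosines:
  fixes a b c :: int assumes "a>0" "b>0" "c>0"
 shows "(\<exists>A B C :: real^2. \<not> collinear {A, B, C} \<and>
        dist B C = of_int a \<and> dist C A = of_int b \<and> dist A B = of_int c \<and>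
        angle_at A B C = 2 * pi / 3) \<longleftrightarrow> a\<^sup>2 = b\<^sup>2 + c\<^sup>2 + b*c" (is "?L \<longleftrightarrow> ?R")
proof
  assume ?L
  then obtain A B C :: "real^2" where h: "dist B C = a" "dist C A = b" "dist A B = c" "angle_at A B C = 2*pi/3" by blast
  define u v where "u = B - A" and "v = C - A"
  have n: "norm u = c" "norm v = b" "norm (u - v) = a" using h by (simp_all add: u_def v_def dist_norm norm_minus_commute)
  have "\<bar>u \<bullet> v\<bar> \<le> norm u * norm v" by (rule Cauchy_Schwarz_ineq2)
  then have "\<bar>u \<bullet> v / (norm u * norm v)\<bar> \<le> 1" using n assms by (simp add: abs_mult field_simps)
  then have "-1/2 = u \<bullet> v / (norm u * norm v)" using h(4) cos_arccos_abs by (metis angle_at_def u_def v_def cos_120)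
  then have "u \<bullet> v = - real_of_int (b * c) / 2" using n assms by (simp add: field_simps)
  moreover have "(norm (u-v))\<^sup>2 = (norm u)\<^sup>2 + (norm v)\<^sup>2 - 2 * (u \<bullet> v)"
    by (simp add: power2_norm_eq_inner inner_diff inner_commute)
  ultimately have "real_of_int (a\<^sup>2) = of_int (b\<^sup>2 + c\<^sup>2 + b*c)" using n by simp
  then show ?R by linarith
next
  assume r: ?R
  let ?A = "0::real^2" and ?C = "vector [b, 0] :: real^2" and ?B = "vector [-c/2, c * sqrt 3/2]::real^2"
  have r': "(real_of_int a)\<^sup>2 = of_int b^2 + of_int c^2 + of_int b* of_int c" using r
    by (metis of_int_add of_int_mult of_int_power)
  have nb: "norm ?B = c" using assms
    by (simp add: norm_real_2 power_mult_distrib power_divide real_sqrt_unique)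
  have nc: "norm ?C = b" using assms by (simp add: norm_real_2)
  have "norm (?B - ?C) = sqrt ((real_of_int a)\<^sup>2)" unfolding norm_real_2 r' by (simp add: power_mult_distrib power_divide power2_eq_square field_simps)
  then have na: "norm (?B - ?C) = a" using assms by simp
  have i: "?B \<bullet> ?C = - real_of_int (b*c)/2" by (simp add: inner_vec_def sum_2)
  have an: "angle_at ?A ?B ?C = 2*pi/3" 
  proof -
    have "(?B - ?A) \<bullet> (?C - ?A) / (norm (?B - ?A) * norm (?C - ?A)) = -1/2"
      unfolding diff_zero i nb nc using assms by (simp add: field_simps)
    then have "angle_at ?A ?B ?C = arccos (cos (2*pi/3))" unfolding angle_at_def by (simp only: cos_120)
    also have "\<dots> = 2*pi/3" by (rule arccos_cos) auto
    finally show ?thesis .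
  qed
  have "\<not> collinear {?A, ?B, ?C}"
  proof
    assume "collinear {?A, ?B, ?C}"
    then have "\<bar>?B \<bullet> ?C\<bar> = norm ?B * norm ?C" by (simp only: norm_cauchy_schwarz_equal)
    then show False using i nb nc assms by simp
  qed
  moreover have "dist ?B ?C = a" using na by (simp only: dist_norm)
  moreover have "dist ?C ?A = b" using nc by (simp only: dist_norm diff_zero)
  moreover have "dist ?A ?B = c" using nb by (simp only: dist_norm diff_0 norm_minus_cancel)
  ultimately show ?L using an by (intro exI conjI)
qed

lemma primitive_sub_eisensteinian_iff:
  "primitive_sub_eisensteinian a b c \<longleftrightarrow>
     a > 0 \<and> b > 0 \<and> c > 0 \<and> gcd a (gcd b c) = 1 \<and> a\<^sup>2 = b\<^sup>2 + c\<^sup>2 + b * c"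
  unfolding primitive_sub_eisensteinian_def using angle_120_iff_law_of_cosines by blast

definition N1 :: "int^3^3" where
  "N1 = vector [vector [7, 0, -6], vector [4, -1, -4], vector [4, 1, -3]]"

definition N2 :: "int^3^3" where
  "N2 = vector [vector [7, 0, 6], vector [4, -1, 3], vector [4, 1, 4]]"

definition N3 :: "int^3^3" where
  "N3 = vector [vector [7, 6, 6], vector [4, 4, 3], vector [4, 3, 4]]"

definition N4 :: "int^3^3" where
  "N4 = vector [vector [7, 6, 0], vector [4, 4, 1], vector [4, 3, -1]]"

definition N5 :: "int^3^3" where
  "N5 = vector [vector [7, -6, 0], vector [4, -3, 1], vector [4, -4, -1]]"

definition matrix_prod :: "(int^3^3) list \<Rightarrow> int^3^3" where
  "matrix_prod w = foldr (**) w (mat 1)"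

definition roots :: "(int^3) set" where
  "roots = {vector [7, 5, 3], vector [13, 7, 8]}"

datatype side_order = ABC | ACB

fun arrange :: "side_order \<Rightarrow> int \<Rightarrow> int \<Rightarrow> int \<Rightarrow> int^3" where
  "arrange ABC a b c = vector [a, b, c]"
| "arrange ACB a b c = vector [a, c, b]"

(* The triple (a, b, c) arises from the word w, the vector v and the chosen form s.
   As N1, ..., N5 are pairwise distinct, a word is a list of the matrices themselves. *)
definition arises_from ::
    "int \<Rightarrow> int \<Rightarrow> int \<Rightarrow> (int^3^3) list \<Rightarrow> int^3 \<Rightarrow> side_order \<Rightarrow> bool" where
  "arises_from a b c w v s \<longleftrightarrow>
     w \<in> lists {N1, N2, N3, N4, N5} \<and> v \<in> roots \<and> arrange s a b c = matrix_prod w *v v"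

end

theory Submission
  imports Defs
begin

text \<open>
  Write a triple as a vector \<open>x = (a, b, c)\<close>. Since \<open>N3\<close> is an integral automorphism of the
  quadratic form \<open>a\<^sup>2 - b\<^sup>2 - c\<^sup>2 - b c\<close>, so is its inverse, and
  \<open>unfold x = (a', p, q)\<close>, the preimage of \<open>x\<close> under \<open>N3\<close>, solves
  \<open>a'\<^sup>2 = p\<^sup>2 + q\<^sup>2 + p q\<close> whenever \<open>x\<close> comes from a triangle. The inequalities
  \<open>a < b + c \<le> 2 a / sqrt 3 < 7 a / 6\<close> give \<open>0 < a' < a\<close>, so this is a descent, except that
  \<open>p\<close> and \<open>q\<close> need not be positive.

  The lines \<open>p = 0\<close>, \<open>q = 0\<close> and \<open>p + q = 0\<close> cut the plane into six sectors which the symmetries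
  of \<open>p\<^sup>2 + q\<^sup>2 + p q\<close> permute. The sector \<open>p, q < 0\<close> does not occur for a triangle. For each of
  the other five, choose a symmetry \<open>G\<close> that carries the positive quadrant onto it. With suitable
  choices, the five products \<open>N3 G\<close> are \<open>N1, ..., N5\<close>. So if \<open>unfold x\<close> lies inside a sector, then
  \<open>x = N y\<close> for exactly one of the five matrices \<open>N\<close> and exactly one triangle \<open>y\<close>
  (\<open>generator_step_inject\<close>, \<open>triangle_descent\<close>). If \<open>unfold x\<close> lies on one of the three lines,
  only finitely many ratios of the sides are possible, and a primitive \<open>x\<close> is \<open>(7, 5, 3)\<close>,
  \<open>(13, 7, 8)\<close> or one of these with \<open>b\<close> and \<open>c\<close> exchanged (\<open>boundary_in_base\<close>).
  Hence every primitive triple is reached from exactly one of these four base triples by exactly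
  one word (\<open>ex_word_base\<close>, \<open>word_base_inject\<close>).

  To get from four base triples to two roots and a choice of the order of \<open>b\<close> and \<open>c\<close>, observe
  that exchanging \<open>b\<close> and \<open>c\<close> conjugates \<open>N1\<close> into \<open>N5\<close> and \<open>N2\<close> into \<open>N4\<close> and fixes \<open>N3\<close>
  (\<open>swap_matrix_prod\<close>): a swapped triple is reached from a swapped root by the mirrored word.
\<close>

section \<open>Triangles as integer vectors\<close>

abbreviation generators :: "(int^3^3) set" where
  "generators \<equiv> {N1, N2, N3, N4, N5}"

definition triangle :: "int^3 \<Rightarrow> bool" where
  "triangle x \<longleftrightarrow> x$1 > 0 \<and> x$2 > 0 \<and> x$3 > 0 \<and> (x$1)\<^sup>2 = (x$2)\<^sup>2 + (x$3)\<^sup>2 + x$2 * x$3"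

definition primitive_vec :: "int^3 \<Rightarrow> bool" where
  "primitive_vec x \<longleftrightarrow> (\<forall>d. (\<forall>i. d dvd x$i) \<longrightarrow> is_unit d)"

lemma vector_3_eq_iff:
  "vector [a, b, c] = (x::int^3) \<longleftrightarrow> a = x$1 \<and> b = x$2 \<and> c = x$3"
  by (auto simp: vec_eq_iff forall_3)

lemma matrix_vector_mult_3:
  "(vector [vector [a1, a2, a3], vector [b1, b2, b3], vector [c1, c2, c3]] :: int^3^3) *v x =
     vector [a1 * x$1 + a2 * x$2 + a3 * x$3, b1 * x$1 + b2 * x$2 + b3 * x$3,
             c1 * x$1 + c2 * x$2 + c3 * x$3]"
  by (simp add: vec_eq_iff forall_3 matrix_vector_mult_def sum_3)

lemma gcd_3_eq_1_iff_primitive_vec: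
  "gcd a (gcd b c) = 1 \<longleftrightarrow> primitive_vec (vector [a, b, c])"
proof
  assume gcd: "gcd a (gcd b c) = 1"
  show "primitive_vec (vector [a, b, c])"
    unfolding primitive_vec_def
  proof (intro allI impI)
    fix d assume "\<forall>i. d dvd (vector [a, b, c] :: int^3)$i"
    then have "d dvd gcd a (gcd b c)" by (simp add: forall_3)
    then show "is_unit d" using gcd by simp
  qed
next
  assume "primitive_vec (vector [a, b, c])"
  moreover have "gcd a (gcd b c) dvd b" "gcd a (gcd b c) dvd c"
    by (auto intro: dvd_trans[OF gcd_dvd2])
  then have "\<forall>i. gcd a (gcd b c) dvd (vector [a, b, c] :: int^3)$i"
    by (simp add: forall_3)
  ultimately have "is_unit (gcd a (gcd b c))"
    unfolding primitive_vec_def by blast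
  then show "gcd a (gcd b c) = 1" by simp
qed

lemma primitive_sub_eisensteinian_iff_triangle:
  "primitive_sub_eisensteinian a b c \<longleftrightarrow>
     triangle (vector [a, b, c]) \<and> primitive_vec (vector [a, b, c])"
  unfolding primitive_sub_eisensteinian_iff gcd_3_eq_1_iff_primitive_vec triangle_def by auto

text \<open>Every divisor of \<open>y\<close> divides \<open>A y\<close>, because the entries of \<open>A\<close> are integers.\<close>

lemma primitive_vec_of_image:
  assumes "primitive_vec (A *v y)"
  shows "primitive_vec y"
  unfolding primitive_vec_def
proof (intro allI impI)
  fix d assume "\<forall>i. d dvd y$i"
  then have "\<forall>i. d dvd (A *v y)$i"
    by (auto simp: matrix_vector_mult_def intro!: dvd_sum)
  then show "is_unit d" using assms by (simp add: primitive_vec_def)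
qed

lemma triangle_bounds:
  assumes "triangle x"
  shows "x$2 < x$1" "x$3 < x$1" "x$2 + 4 * x$3 < 4 * x$1" "4 * x$2 + x$3 < 4 * x$1"
    "x$1 < x$2 + x$3" "6 * (x$2 + x$3) < 7 * x$1"
proof -
  define a b c where "a = x$1" and "b = x$2" and "c = x$3"
  note abc = a_def[symmetric] b_def[symmetric] c_def[symmetric]
  have pos: "a > 0" "b > 0" "c > 0" and eq: "a\<^sup>2 = b\<^sup>2 + c\<^sup>2 + b * c"
    using assms by (simp_all add: triangle_def abc)
  have sq: "b\<^sup>2 > 0" "c\<^sup>2 > 0" "b * c > 0" using pos by simp_all
  have root_less: "u < v" if "u\<^sup>2 < v\<^sup>2" "v > 0" for u v :: int
    using power2_less_imp_less[OF that(1)] that(2) by simp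
  have "b\<^sup>2 < a\<^sup>2" "c\<^sup>2 < a\<^sup>2" using eq sq by linarith+
  then show "x$2 < x$1" "x$3 < x$1"
    using root_less[of b a] root_less[of c a] pos by (simp_all add: abc)
  have "(b + 4 * c)\<^sup>2 < (4 * a)\<^sup>2" "(4 * b + c)\<^sup>2 < (4 * a)\<^sup>2" "a\<^sup>2 < (b + c)\<^sup>2"
    using eq sq by (simp_all add: power2_eq_square algebra_simps)
  then show "x$2 + 4 * x$3 < 4 * x$1" "4 * x$2 + x$3 < 4 * x$1" "x$1 < x$2 + x$3"
    using root_less[of "b + 4 * c" "4 * a"] root_less[of "4 * b + c" "4 * a"]
      root_less[of a "b + c"] pos by (simp_all add: abc)
  have "(7 * a)\<^sup>2 = (6 * (b + c))\<^sup>2 + 13 * (b - c)\<^sup>2 + 3 * (b * c)"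
    using eq by (simp add: power2_eq_square algebra_simps)
  then have "(6 * (b + c))\<^sup>2 < (7 * a)\<^sup>2"
    using sq(3) zero_le_power2[of "b - c"] by linarith
  then show "6 * (x$2 + x$3) < 7 * x$1"
    using root_less[of "6 * (b + c)" "7 * a"] pos by (simp add: abc)
qed

section \<open>The action of the generators\<close>

text \<open>The action of the inverse of \<open>N3\<close>, which is again an integer matrix.\<close>

definition unfold :: "int^3 \<Rightarrow> int^3" where
  "unfold x = vector [7 * x$1 - 6 * x$2 - 6 * x$3, 4 * x$2 + 3 * x$3 - 4 * x$1,
                      3 * x$2 + 4 * x$3 - 4 * x$1]"

lemmas generator_mult =
  N1_def[THEN arg_cong[of _ _ "\<lambda>N. N *v x"], unfolded matrix_vector_mult_3]
  N2_def[THEN arg_cong[of _ _ "\<lambda>N. N *v x"], unfolded matrix_vector_mult_3]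
  N3_def[THEN arg_cong[of _ _ "\<lambda>N. N *v x"], unfolded matrix_vector_mult_3]
  N4_def[THEN arg_cong[of _ _ "\<lambda>N. N *v x"], unfolded matrix_vector_mult_3]
  N5_def[THEN arg_cong[of _ _ "\<lambda>N. N *v x"], unfolded matrix_vector_mult_3]
  for x :: "int^3"

text \<open>The first coordinate recovers the longest side of \<open>y\<close>, and the last two show the sector into which each generator sends the positive
  quadrant; the five sectors are bounded by the lines \<open>p = 0\<close>, \<open>q = 0\<close> and \<open>p + q = 0\<close>.\<close>

lemma unfold_generator:
  "unfold (N1 *v y) = vector [y$1, - y$2 - y$3, y$2]"
  "unfold (N2 *v y) = vector [y$1, - y$2, y$2 + y$3]"
  "unfold (N3 *v y) = vector [y$1, y$2, y$3]"
  "unfold (N4 *v y) = vector [y$1, y$2 + y$3, - y$3]"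
  "unfold (N5 *v y) = vector [y$1, y$3, - y$2 - y$3]"
  by (simp_all add: unfold_def generator_mult vector_3_eq_iff)

lemma triangle_generator_mult:
  assumes "N \<in> generators" "triangle y"
  shows "triangle (N *v y)"
proof -
  have pos: "y$1 > 0" "y$2 > 0" "y$3 > 0"
    and eq: "y$1 * y$1 = y$2 * y$2 + y$3 * y$3 + y$2 * y$3"
    using assms(2) by (simp_all add: triangle_def power2_eq_square)
  note bounds = triangle_bounds[OF assms(2)]
  from assms(1) consider "N = N1" | "N = N2" | "N = N3" | "N = N4" | "N = N5" by blast
  then show ?thesis
    by cases (use pos bounds eq in
      \<open>simp_all add: triangle_def generator_mult power2_eq_square algebra_simps\<close>)
qed

lemma primitive_vec_generator_mult:
  assumes "N \<in> generators" "primitive_vec y"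
  shows "primitive_vec (N *v y)"
  unfolding primitive_vec_def
proof (intro allI impI)
  fix d assume "\<forall>i. d dvd (N *v y)$i"
  then have "\<forall>i. d dvd unfold (N *v y)$i"
    by (simp add: unfold_def forall_3)
  then have "\<forall>i. d dvd y$i"
    using assms(1) by (auto simp: unfold_generator forall_3 dvd_add_right_iff
        dvd_add_left_iff dvd_diff_right_iff dvd_diff_left_iff)
  then show "is_unit d" using assms(2) by (simp add: primitive_vec_def)
qed

text \<open>The sectors of different generators are disjoint, so the signs of the coordinates of
  \<open>unfold (N y)\<close> reveal \<open>N\<close>; then \<open>y\<close> can be read off.\<close>

lemma generator_step_inject:
  assumes "N \<in> generators" "M \<in> generators" "triangle y" "triangle z" "N *v y = M *v z"
  shows "N = M \<and> y = z"
proof -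
  have "unfold (N *v y) = unfold (M *v z)" using assms(5) by simp
  moreover have "y$2 > 0" "y$3 > 0" "z$2 > 0" "z$3 > 0"
    using assms(3,4) by (simp_all add: triangle_def)
  ultimately show ?thesis using assms(1,2)
    by (auto simp: unfold_generator vector_3_eq_iff vec_eq_iff[of y] forall_3)
qed

section \<open>Descent to the base triples\<close>

definition base :: "(int^3) set" where
  "base = {vector [7, 5, 3], vector [7, 3, 5], vector [13, 7, 8], vector [13, 8, 7]}"

lemma base_triangle: "r \<in> base \<Longrightarrow> triangle r"
  by (auto simp: base_def triangle_def)

lemma base_primitive:
  assumes "r \<in> base"
  shows "primitive_vec r"
proof -
  have "is_unit d" if "d dvd 7" "d dvd 3" for d :: int
    using dvd_diff[OF that(1) dvd_mult[OF that(2), of 2]] by simp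
  moreover have "is_unit d" if "d dvd 7" "d dvd 8" for d :: int
    using dvd_diff[OF that(2,1)] by simp
  ultimately show ?thesis
    using assms unfolding base_def primitive_vec_def forall_3 by auto
qed

text \<open>Base triples unfold onto the boundary lines of the sectors, while the image of a triangle
  under a generator unfolds into the interior of a sector.\<close>

lemma generator_mult_notin_base:
  assumes "N \<in> generators" "triangle y"
  shows "N *v y \<notin> base"
proof
  assume "N *v y \<in> base"
  then have "unfold (N *v y) \<in> unfold ` base" by blast
  moreover have "y$2 > 0" "y$3 > 0" using assms(2) by (simp_all add: triangle_def)
  ultimately show False using assms(1)
    by (auto simp: base_def vector_3_eq_iff unfold_def generator_mult)
qed

lemma primitive_vec_multiple:
  assumes "primitive_vec (vector [m * k, n * k, l * k])" "k > 0"
  shows "k = 1"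
proof -
  have "is_unit k" using assms(1) by (simp add: primitive_vec_def forall_3)
  then show ?thesis using assms(2) by simp
qed

text \<open>On each of the three boundary lines the quadratic equation leaves only finitely many ratios
  \<open>b : c\<close>, and primitivity then determines the triple.\<close>

lemma boundary_in_base:
  assumes "triangle x" "primitive_vec x"
    and "unfold x$2 = 0 \<or> unfold x$3 = 0 \<or> unfold x$2 + unfold x$3 = 0"
  shows "x \<in> base"
proof -
  define a b c where "a = x$1" and "b = x$2" and "c = x$3"
  have x: "x = vector [a, b, c]"
    by (simp add: a_def b_def c_def vec_eq_iff forall_3)
  have pos: "a > 0" "b > 0" "c > 0" and eq: "a\<^sup>2 = b\<^sup>2 + c\<^sup>2 + b * c"
    using assms(1) by (simp_all add: triangle_def x)
  have eq16: "(4 * a)\<^sup>2 = 16 * (b\<^sup>2 + c\<^sup>2 + b * c)" using eq by (simp add: power_mult_distrib)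
  from assms(3) consider "4 * a = 4 * b + 3 * c" | "4 * a = 3 * b + 4 * c" | "8 * a = 7 * (b + c)"
    by (auto simp: unfold_def x algebra_simps)
  then show ?thesis
  proof cases
    case 1
    have "c * (8 * b - 7 * c) = 0"
      using eq16 unfolding 1 by (simp add: power2_eq_square algebra_simps)
    then have ratio: "8 * b = 7 * c" using pos by simp
    define k where "k = c - b"
    with ratio have k: "k > 0" "b = 7 * k" "c = 8 * k"
      using pos by linarith+
    with 1 have "a = 13 * k" by simp
    then have "k = 1" using assms(2) k primitive_vec_multiple[of 13 k 7 8] by (simp add: x)
    then show ?thesis using k \<open>a = 13 * k\<close> by (simp add: x base_def)
  next
    case 2
    have "b * (8 * c - 7 * b) = 0"
      using eq16 unfolding 2 by (simp add: power2_eq_square algebra_simps)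
    then have ratio: "7 * b = 8 * c" using pos by simp
    define k where "k = b - c"
    with ratio have k: "k > 0" "b = 8 * k" "c = 7 * k"
      using pos by linarith+
    with 2 have "a = 13 * k" by simp
    then have "k = 1" using assms(2) k primitive_vec_multiple[of 13 k 8 7] by (simp add: x)
    then show ?thesis using k \<open>a = 13 * k\<close> by (simp add: x base_def)
  next
    case 3
    have "(8 * a)\<^sup>2 = 64 * (b\<^sup>2 + c\<^sup>2 + b * c)" using eq by (simp add: power_mult_distrib)
    then have "(3 * b - 5 * c) * (5 * b - 3 * c) = 0"
      unfolding 3 by (simp add: power2_eq_square algebra_simps)
    then consider "3 * b = 5 * c" | "5 * b = 3 * c" by auto
    then show ?thesis
    proof cases
      case ratio: 1
      define k where "k = 2 * c - b"
      with ratio have k: "k > 0" "b = 5 * k" "c = 3 * k"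
        using pos by linarith+
      with 3 have "a = 7 * k" by simp
      then have "k = 1" using assms(2) k primitive_vec_multiple[of 7 k 5 3] by (simp add: x)
      then show ?thesis using k \<open>a = 7 * k\<close> by (simp add: x base_def)
    next
      case ratio: 2
      define k where "k = 2 * b - c"
      with ratio have k: "k > 0" "b = 3 * k" "c = 5 * k"
        using pos by linarith+
      with 3 have "a = 7 * k" by simp
      then have "k = 1" using assms(2) k primitive_vec_multiple[of 7 k 3 5] by (simp add: x)
      then show ?thesis using k \<open>a = 7 * k\<close> by (simp add: x base_def)
    qed
  qed
qed

text \<open>The sixth sector is empty: \<open>p \<le> 0\<close> forces \<open>7 c \<ge> 8 b\<close>, whereas \<open>q \<le> 0\<close> forces
  \<open>7 b \<ge> 8 c\<close>.\<close>

lemma unfold_not_both_nonpos: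
  assumes "triangle x"
  shows "unfold x$2 > 0 \<or> unfold x$3 > 0"
proof (rule ccontr)
  assume neg: "\<not> ?thesis"
  define a b c where "a = x$1" and "b = x$2" and "c = x$3"
  have pos: "a > 0" "b > 0" "c > 0" and eq: "a\<^sup>2 = b\<^sup>2 + c\<^sup>2 + b * c"
    using assms by (simp_all add: triangle_def a_def b_def c_def)
  have "4 * b + 3 * c \<le> 4 * a" "3 * b + 4 * c \<le> 4 * a"
    using neg by (simp_all add: unfold_def a_def b_def c_def)
  then have "(4 * b + 3 * c)\<^sup>2 \<le> (4 * a)\<^sup>2" "(3 * b + 4 * c)\<^sup>2 \<le> (4 * a)\<^sup>2"
    using pos by (intro power_mono; simp)+
  then have "c * (8 * b) \<le> c * (7 * c)" "b * (8 * c) \<le> b * (7 * b)"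
    using eq by (simp_all add: power2_eq_square algebra_simps)
  then show False using pos by simp
qed

text \<open>One descent step: undo the symmetry that belongs to the sector of \<open>unfold x\<close>.\<close>

lemma triangle_descent:
  assumes "triangle x" "primitive_vec x" "x \<notin> base"
  obtains (step) N y where "N \<in> generators" "triangle y" "primitive_vec y" "x = N *v y" "y$1 < x$1"
proof -
  define a' p q where "a' = unfold x$1" and "p = unfold x$2" and "q = unfold x$3"
  have inv: "x$1 = 7 * a' + 6 * p + 6 * q" "x$2 = 4 * a' + 4 * p + 3 * q"
      "x$3 = 4 * a' + 3 * p + 4 * q"
    by (simp_all add: a'_def p_def q_def unfold_def)
  have "(x$1)\<^sup>2 = (x$2)\<^sup>2 + (x$3)\<^sup>2 + x$2 * x$3" using assms(1) by (simp add: triangle_def)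
  then have eq: "a' * a' = p * p + q * q + p * q"
    unfolding inv by (simp add: power2_eq_square algebra_simps)
  have a': "a' > 0" "a' < x$1"
    using triangle_bounds[OF assms(1)] by (simp_all add: a'_def unfold_def)
  have nz: "p \<noteq> 0" "q \<noteq> 0" "p + q \<noteq> 0"
    using boundary_in_base assms unfolding p_def q_def by blast+
  have "p > 0 \<or> q > 0" using unfold_not_both_nonpos[OF assms(1)] by (simp add: p_def q_def)
  \<comment> \<open>Primitivity and the decrease of the longest side hold in every sector.\<close>
  have finish: thesis
    if y: "N \<in> generators" "triangle y" "x = N *v y" "y$1 = a'" for N y
  proof (rule step)
    show "primitive_vec y" using y(3) assms(2) by (simp add: primitive_vec_of_image)
    show "y$1 < x$1" using y(4) a' by simp
  qed (use y in blast)+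
  from \<open>p > 0 \<or> q > 0\<close> nz consider "q > 0" "p + q < 0" | "p < 0" "p + q > 0" | "p > 0" "q > 0"
    | "q < 0" "p + q > 0" | "p > 0" "p + q < 0" by linarith
  then show thesis
  proof cases
    case 1
    show ?thesis by (rule finish[of N1 "vector [a', q, - p - q]"])
        (use 1 a' eq in \<open>simp_all add: triangle_def power2_eq_square algebra_simps
          generator_mult vec_eq_iff[of x] forall_3 inv\<close>)
  next
    case 2
    show ?thesis by (rule finish[of N2 "vector [a', - p, p + q]"])
        (use 2 a' eq in \<open>simp_all add: triangle_def power2_eq_square algebra_simps
          generator_mult vec_eq_iff[of x] forall_3 inv\<close>)
  next
    case 3
    show ?thesis by (rule finish[of N3 "vector [a', p, q]"])
        (use 3 a' eq in \<open>simp_all add: triangle_def power2_eq_square algebra_simps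
          generator_mult vec_eq_iff[of x] forall_3 inv\<close>)
  next
    case 4
    show ?thesis by (rule finish[of N4 "vector [a', p + q, - q]"])
        (use 4 a' eq in \<open>simp_all add: triangle_def power2_eq_square algebra_simps
          generator_mult vec_eq_iff[of x] forall_3 inv\<close>)
  next
    case 5
    show ?thesis by (rule finish[of N5 "vector [a', - p - q, p]"])
        (use 5 a' eq in \<open>simp_all add: triangle_def power2_eq_square algebra_simps
          generator_mult vec_eq_iff[of x] forall_3 inv\<close>)
  qed
qed

section \<open>Words in the generators\<close>

lemma matrix_prod_Nil_mult: "matrix_prod [] *v r = r"
  by (simp add: matrix_prod_def)

lemma matrix_prod_Cons_mult: "matrix_prod (N # w) *v r = N *v (matrix_prod w *v r)"
  by (simp add: matrix_prod_def matrix_vector_mul_assoc)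

lemma matrix_prod_triangle:
  assumes "w \<in> lists generators" "r \<in> base"
  shows "triangle (matrix_prod w *v r) \<and> primitive_vec (matrix_prod w *v r)"
  using assms(1)
proof induction
  case Nil
  then show ?case using assms(2) base_triangle base_primitive
    by (simp add: matrix_prod_Nil_mult)
next
  case (Cons N w)
  then show ?case using triangle_generator_mult primitive_vec_generator_mult
    by (simp only: matrix_prod_Cons_mult)
qed

lemma ex_word_base:
  assumes "triangle x" "primitive_vec x"
  shows "\<exists>w r. w \<in> lists generators \<and> r \<in> base \<and> x = matrix_prod w *v r"
  using assms
proof (induction "nat (x$1)" arbitrary: x rule: less_induct)
  case less
  show ?case
  proof (cases "x \<in> base")
    case True
    then show ?thesis by (intro exI[of _ "[]"] exI[of _ x]) (simp add: matrix_prod_Nil_mult)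
  next
    case False
    with less.prems obtain N y where y: "N \<in> generators" "triangle y" "primitive_vec y"
        "x = N *v y" "y$1 < x$1"
      by (rule triangle_descent)
    then have "nat (y$1) < nat (x$1)" by (simp add: triangle_def)
    with less.hyps y obtain w r where "w \<in> lists generators" "r \<in> base" "y = matrix_prod w *v r"
      by blast
    with y have "N # w \<in> lists generators \<and> r \<in> base \<and> x = matrix_prod (N # w) *v r"
      by (simp only: matrix_prod_Cons_mult lists.Cons simp_thms)
    then show ?thesis by blast
  qed
qed

text \<open>The letters of a word can be read off from the left one at a time, and the word has ended
  as soon as a base triple is reached.\<close>

lemma word_base_inject:
  assumes "w \<in> lists generators" "w' \<in> lists generators" "r \<in> base" "r' \<in> base"
    and "matrix_prod w *v r = matrix_prod w' *v r'"
  shows "w = w' \<and> r = r'"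
proof -
  have not_base: "matrix_prod (M # u) *v t \<notin> base"
    if "M \<in> generators" "u \<in> lists generators" "t \<in> base" for M u t
    unfolding matrix_prod_Cons_mult
    by (intro generator_mult_notin_base matrix_prod_triangle[THEN conjunct1] that)
  show ?thesis
    using assms(1,2,5)
  proof (induction w arbitrary: w' rule: lists.induct)
    case Nil
    show ?case
    proof (cases w')
      case Nil
      then show ?thesis using Nil.prems by (simp add: matrix_prod_Nil_mult)
    next
      case (Cons M u)
      then have "M \<in> generators" "u \<in> lists generators" using Nil.prems by auto
      then have "matrix_prod w' *v r' \<notin> base"
        using Cons not_base assms(4) by blast
      then show ?thesis using Nil.prems assms(3) by (simp add: matrix_prod_Nil_mult)
    qed
  next
    case step: (Cons N u)
    show ?case
    proof (cases w')
      case Nil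
      have "matrix_prod (N # u) *v r \<notin> base" using step.hyps not_base assms(3) by blast
      then show ?thesis using step.prems Nil assms(4) by (simp add: matrix_prod_Nil_mult)
    next
      case (Cons M u')
      then have M: "M \<in> generators" "u' \<in> lists generators" using step.prems by auto
      have "N *v (matrix_prod u *v r) = M *v (matrix_prod u' *v r')"
        using step.prems Cons by (simp add: matrix_prod_Cons_mult)
      then have "N = M \<and> matrix_prod u *v r = matrix_prod u' *v r'"
        by (intro generator_step_inject step.hyps M matrix_prod_triangle[THEN conjunct1] assms(3,4))
      then show ?thesis using step.IH M Cons by blast
    qed
  qed
qed

section \<open>Exchanging the two shorter sides\<close>

definition swap_matrix :: "int^3^3" where
  "swap_matrix = vector [vector [1, 0, 0], vector [0, 0, 1], vector [0, 1, 0]]"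

definition mirror :: "int^3^3 \<Rightarrow> int^3^3" where
  "mirror N = swap_matrix ** N ** swap_matrix"

lemma swap_matrix_mult: "swap_matrix *v x = vector [x$1, x$3, x$2]"
  by (simp add: swap_matrix_def matrix_vector_mult_3)

lemma swap_matrix_involution: "swap_matrix ** swap_matrix = mat 1"
  by (simp add: swap_matrix_def matrix_matrix_mult_def mat_def vec_eq_iff forall_3 sum_3)

lemma swap_swap: "swap_matrix *v (swap_matrix *v x) = x"
  by (simp add: matrix_vector_mul_assoc swap_matrix_involution)

lemma mirror_mirror: "mirror (mirror N) = N"
proof -
  have "mirror (mirror N) = (swap_matrix ** swap_matrix) ** N ** (swap_matrix ** swap_matrix)"
    by (simp only: mirror_def matrix_mul_assoc)
  then show ?thesis by (simp add: swap_matrix_involution)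
qed

lemma map_mirror_mirror: "map mirror (map mirror w) = w"
  by (simp add: mirror_mirror o_def)

lemma mirror_generators:
  "mirror N1 = N5" "mirror N2 = N4" "mirror N3 = N3" "mirror N4 = N2" "mirror N5 = N1"
  by (simp_all add: mirror_def swap_matrix_def N1_def N2_def N3_def N4_def N5_def
      matrix_matrix_mult_def vec_eq_iff forall_3 sum_3)

lemma map_mirror_generators:
  "w \<in> lists generators \<Longrightarrow> map mirror w \<in> lists generators"
  by (induction rule: lists.induct) (auto simp: mirror_generators)

lemma swap_matrix_prod:
  "swap_matrix *v (matrix_prod w *v v) = matrix_prod (map mirror w) *v (swap_matrix *v v)"
proof (induction w)
  case Nil
  show ?case by (simp add: matrix_prod_Nil_mult)
next
  case (Cons N w)
  have "swap_matrix *v (N *v u) = mirror N *v (swap_matrix *v u)" for u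
    unfolding mirror_def by (simp only: matrix_vector_mul_assoc[symmetric] swap_swap)
  then show ?case using Cons.IH by (simp add: matrix_prod_Cons_mult)
qed

lemma base_eq_roots: "base = roots \<union> (*v) swap_matrix ` roots"
  by (auto simp: base_def roots_def swap_matrix_mult)

lemma roots_Int_swapped_roots: "roots \<inter> (*v) swap_matrix ` roots = {}"
  by (auto simp: roots_def swap_matrix_mult vector_3_eq_iff)

lemma arises_from_ABC_iff:
  "arises_from a b c w v ABC \<longleftrightarrow>
     w \<in> lists generators \<and> v \<in> roots \<and> vector [a, b, c] = matrix_prod w *v v"
  by (simp add: arises_from_def)

text \<open>The form \<open>(a, c, b)\<close> amounts to starting from a swapped root and mirroring the word.\<close>

lemma arises_from_ACB_iff:
  "arises_from a b c w v ACB \<longleftrightarrow>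
     map mirror w \<in> lists generators \<and> v \<in> roots \<and>
     vector [a, b, c] = matrix_prod (map mirror w) *v (swap_matrix *v v)"
proof -
  have "w \<in> lists generators \<longleftrightarrow> map mirror w \<in> lists generators"
    using map_mirror_generators map_mirror_mirror by metis
  moreover have "vector [a, c, b] = swap_matrix *v vector [a, b, c]"
    by (simp add: swap_matrix_mult)
  then have "vector [a, c, b] = matrix_prod w *v v \<longleftrightarrow>
      vector [a, b, c] = swap_matrix *v (matrix_prod w *v v)"
    using swap_swap by metis
  ultimately show ?thesis by (simp add: arises_from_def swap_matrix_prod)
qed

theorem theorem4:
  shows "(\<forall>a b c. primitive_sub_eisensteinian a b c \<longleftrightarrow> (\<exists>w v s. arises_from a b c w v s)) \<and>
         (\<forall>a b c. primitive_sub_eisensteinian a b c \<longrightarrow> (\<exists>!(w, v, s). arises_from a b c w v s))"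
proof -
  have sound: "primitive_sub_eisensteinian a b c"
    if arises: "arises_from a b c w v s" for a b c w v s
  proof -
    have "\<exists>w r. w \<in> lists generators \<and> r \<in> base \<and> vector [a, b, c] = matrix_prod w *v r"
      using arises by (cases s) (auto simp only: arises_from_ABC_iff arises_from_ACB_iff base_eq_roots)
    then show ?thesis
      using matrix_prod_triangle by (metis primitive_sub_eisensteinian_iff_triangle)
  qed
  have unique: "\<exists>!(w, v, s). arises_from a b c w v s"
    if pse: "primitive_sub_eisensteinian a b c" for a b c
  proof -
    obtain w r where wr: "w \<in> lists generators" "r \<in> base" "vector [a, b, c] = matrix_prod w *v r"
      using pse ex_word_base primitive_sub_eisensteinian_iff_triangle by blast
    have word: "u = w \<and> t = r"
      if "u \<in> lists generators" "t \<in> base" "vector [a, b, c] = matrix_prod u *v t" for u t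
      using word_base_inject that wr by metis
    have word_ABC: "u = w \<and> v = r" if "arises_from a b c u v ABC" for u v
      using that word unfolding arises_from_ABC_iff base_eq_roots by blast
    have word_ACB: "map mirror u = w \<and> swap_matrix *v v = r" if "arises_from a b c u v ACB" for u v
      using that word unfolding arises_from_ACB_iff base_eq_roots by blast
    \<comment> \<open>Whether the base triple is a root or a swapped root decides the form.\<close>
    consider "r \<in> roots" | v where "v \<in> roots" "r = swap_matrix *v v"
      using wr(2) base_eq_roots by blast
    then show ?thesis
    proof cases
      case 1
      then have "arises_from a b c w r ABC" using wr by (simp add: arises_from_ABC_iff)
      moreover have "u = w \<and> v = r \<and> s = ABC" if arises: "arises_from a b c u v s" for u v s
      proof (cases s)
        case ABC
        then show ?thesis using arises word_ABC by blast
      next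
        case ACB
        then have "swap_matrix *v v = r" "v \<in> roots"
          using arises word_ACB
          by (auto simp: arises_from_def)
        then show ?thesis using 1 roots_Int_swapped_roots by blast
      qed
      ultimately show ?thesis by (auto simp: Ex1_def)
    next
      case (2 v0)
      then have "arises_from a b c (map mirror w) v0 ACB"
        using wr by (simp only: arises_from_ACB_iff map_mirror_mirror simp_thms)
      moreover have "u = map mirror w \<and> v = v0 \<and> s = ACB"
        if arises: "arises_from a b c u v s" for u v s
      proof (cases s)
        case ABC
        then have "v = r" "v \<in> roots"
          using arises word_ABC
          by (auto simp: arises_from_def)
        then show ?thesis using 2 roots_Int_swapped_roots by blast
      next
        case ACB
        then have "map mirror u = w" "swap_matrix *v v = r"
          using arises word_ACB
          by blast+
        then show ?thesis using ACB 2 map_mirror_mirror swap_swap by metis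
      qed
      ultimately show ?thesis by (auto simp: Ex1_def)
    qed
  qed
  have complete: "\<exists>w v s. arises_from a b c w v s"
    if pse: "primitive_sub_eisensteinian a b c" for a b c
    using ex1_implies_ex[OF unique[OF pse]] by auto
  show ?thesis using sound complete unique by (intro conjI allI iffI impI; (elim exE)?) blast+
qed

end
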